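(* Let $B=-B$ be a subset of a finite additive Abelian group $\Gamma$. Let $H=\mathrm{Cayley}(\Gamma,B)$ be the graph on vertex set $\Gamma$ with an edge joining vertices $i$ and $j$ if and only if $j-i\in B$, and let $\widehat{H}$ be the edge-weighted Cayley graph on vertex set $\Gamma$ with edge $ij$ having weight $\widehat{\delta_B}(j-i)$. Then, for every finite graph $G=(V,E)$, the number of $B$-tensions of $G$ is equal to $$|\Gamma|^{-c(G)}\,\mathrm{hom}(G,H),$$ and the number of $B$-flows of $G$ is equal to $$|\Gamma|^{-|V|}\,\mathrm{hom}(G,\widehat{H}),$$ where $c(G)$ is the number of connected components of $G$.
   Context: **Flows and tensions.** Let $G=(V,E)$ be a finite graph (parallel edges and loops allowed) with an arbitrary fixed orientation of its edges. A $\Gamma$-flow is a function $g:E\to\Gamma$ such that for every vertex $v$ the sum of $g(e)$ over non-loop edges $e$ with head $v$ equals the sum of $g(e)$ over non-loop edges $e$ with tail $v$. A $\Gamma$-tension is a function $g:E\to\Gamma$ for which there is $f:V\to\Gamma$ with $g(e)=f(v)-f(u)$ for each edge $e$ with tail $u$ and head $v$. A $B$-flow (resp. $B$-tension) is a $\Gamma$-flow (resp. $\Gamma$-tension) all of whose values lie in $B$. **Fourier transform.** Fix a commutative ring structure with unity on $\Gamma$ and a generating character $\chi$, i.e. a homomorphism $\chi:\Gamma\to\mathbb{C}^\times$ such that, writing $\chi_x(y)=\chi(xy)$, the map $x\mapsto\chi_x$ is an isomorphism from $\Gamma$ to its character group (such a choice always exists). For $\alpha:\Gamma\to\mathbb{C}$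 its Fourier transform is $\widehat{\alpha}(y)=\sum_{x\in\Gamma}\alpha(x)\chi_y(-x)$. $\delta_B$ is the indicator function of $B$. **Homomorphism numbers.** For an edge-weighted graph $K$ with symmetric adjacency matrix $(\beta_K(ij))$ of real edge weights (all vertex weights 1), $\mathrm{hom}(G,K)=\sum_{\psi:V(G)\to V(K)}\prod_{uv\in E(G)}\beta_K(\psi(u)\psi(v))$, the product taken over edges with multiplicity (a loop at $u$ contributes $\beta_K(\psi(u)\psi(u))$). For an unweighted graph $K$, edges have weight 1 and non-edges weight 0. *)

theory Defs
  imports
    Complex_Main
    "HOL-Library.FuncSet"
    "HOL-Library.Indicator_Function"
    "HOL-Algebra.Multiplicative_Group"
    "Graph_Theory.Digraph_Component"
begin

section \<open>Connected components\<close>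

text \<open>
  A finite graph with a fixed orientation is a \<^locale>\<open>fin_digraph\<close>, which admits loops and
  parallel arcs.  The library defines connectedness of \<open>G\<close> as strong connectedness of its
  symmetric closure; accordingly, the connected components are the strong components of that
  closure.
\<close>

definition num_components :: "('v, 'e) pre_digraph \<Rightarrow> nat" where
  "num_components G = card (pre_digraph.sccs (with_proj (mk_symmetric G)))"

section \<open>Flows and tensions\<close>

text \<open>
  Functions on the arcs are taken extensional (undefined off \<^term>\<open>arcs G\<close>), so that \<^const>\<open>card\<close>
  counts functions \<open>E \<rightarrow> \<Gamma>\<close>.
\<close>

definition flows :: "('v, 'e) pre_digraph \<Rightarrow> ('a, 'm) ring_scheme \<Rightarrow> ('e \<Rightarrow> 'a) set" where
  "flows G \<Gamma> = {g \<in> arcs G \<rightarrow>\<^sub>E carrier \<Gamma>. \<forall>v \<in> verts G.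
     (\<Oplus>\<^bsub>\<Gamma>\<^esub> e \<in> {e \<in> arcs G. tail G e \<noteq> head G e \<and> head G e = v}. g e) =
     (\<Oplus>\<^bsub>\<Gamma>\<^esub> e \<in> {e \<in> arcs G. tail G e \<noteq> head G e \<and> tail G e = v}. g e)}"

definition tensions :: "('v, 'e) pre_digraph \<Rightarrow> ('a, 'm) ring_scheme \<Rightarrow> ('e \<Rightarrow> 'a) set" where
  "tensions G \<Gamma> = {g \<in> arcs G \<rightarrow>\<^sub>E carrier \<Gamma>. \<exists>f \<in> verts G \<rightarrow> carrier \<Gamma>.
     \<forall>e \<in> arcs G. g e = f (head G e) \<ominus>\<^bsub>\<Gamma>\<^esub> f (tail G e)}"

definition B_flows ::
  "('v, 'e) pre_digraph \<Rightarrow> ('a, 'm) ring_scheme \<Rightarrow> 'a set \<Rightarrow> ('e \<Rightarrow> 'a) set" where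
  "B_flows G \<Gamma> B = {g \<in> flows G \<Gamma>. \<forall>e \<in> arcs G. g e \<in> B}"

definition B_tensions ::
  "('v, 'e) pre_digraph \<Rightarrow> ('a, 'm) ring_scheme \<Rightarrow> 'a set \<Rightarrow> ('e \<Rightarrow> 'a) set" where
  "B_tensions G \<Gamma> B = {g \<in> tensions G \<Gamma>. \<forall>e \<in> arcs G. g e \<in> B}"

section \<open>Characters and the Fourier transform\<close>

text \<open>
  \<^term>\<open>abelian_group \<Gamma>\<close> constrains only the carrier and the additive fields of the record \<open>\<Gamma>\<close>;
  strengthening it to \<^term>\<open>cring \<Gamma>\<close> is a choice of commutative ring structure with unity on that
  group.
\<close>

definition complex_units :: "complex monoid" where
  "complex_units = \<lparr>carrier = UNIV - {0}, monoid.mult = (*), one = 1\<rparr>"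

definition character_group :: "('a, 'm) ring_scheme \<Rightarrow> ('a \<Rightarrow> complex) monoid" where
  "character_group \<Gamma> =
    \<lparr>carrier = hom (add_monoid \<Gamma>) complex_units \<inter> extensional (carrier \<Gamma>),
     monoid.mult = (\<lambda>\<phi> \<psi>. \<lambda>x \<in> carrier \<Gamma>. \<phi> x * \<psi> x),
     one = (\<lambda>x \<in> carrier \<Gamma>. 1)\<rparr>"

definition char_twist :: "('a, 'm) ring_scheme \<Rightarrow> ('a \<Rightarrow> complex) \<Rightarrow> 'a \<Rightarrow> 'a \<Rightarrow> complex" where
  "char_twist \<Gamma> \<chi> x = (\<lambda>y \<in> carrier \<Gamma>. \<chi> (x \<otimes>\<^bsub>\<Gamma>\<^esub> y))"

definition generating_character :: "('a, 'm) ring_scheme \<Rightarrow> ('a \<Rightarrow> complex) \<Rightarrow> bool" where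
  "generating_character \<Gamma> \<chi> \<longleftrightarrow>
     \<chi> \<in> hom (add_monoid \<Gamma>) complex_units \<and>
     char_twist \<Gamma> \<chi> \<in> iso (add_monoid \<Gamma>) (character_group \<Gamma>)"

definition fourier ::
  "('a, 'm) ring_scheme \<Rightarrow> ('a \<Rightarrow> complex) \<Rightarrow> ('a \<Rightarrow> complex) \<Rightarrow> 'a \<Rightarrow> complex" where
  "fourier \<Gamma> \<chi> \<alpha> y = (\<Sum>x \<in> carrier \<Gamma>. \<alpha> x * char_twist \<Gamma> \<chi> y (\<ominus>\<^bsub>\<Gamma>\<^esub> x))"

section \<open>Edge-weighted graphs and homomorphism numbers\<close>

record ('a, 'w) weighted_graph =
  nodes :: "'a set"
  weight :: "'a \<Rightarrow> 'a \<Rightarrow> 'w"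

text \<open>
  The orientation of \<open>G\<close> only serves to name the two ends of an edge; it is immaterial
  because \<^const>\<open>weight\<close> is symmetric in every use below.
\<close>

definition hom_number ::
  "('v, 'e) pre_digraph \<Rightarrow> ('a, 'w :: comm_semiring_1) weighted_graph \<Rightarrow> 'w" where
  "hom_number G K =
     (\<Sum>\<psi> \<in> verts G \<rightarrow>\<^sub>E nodes K. \<Prod>e \<in> arcs G. weight K (\<psi> (tail G e)) (\<psi> (head G e)))"

text \<open>An undirected graph without parallel edges is given by its symmetric adjacency relation.\<close>

definition unit_weighted :: "'a pair_pre_digraph \<Rightarrow> ('a, 'w :: comm_semiring_1) weighted_graph" where
  "unit_weighted K =
     \<lparr>nodes = pverts K, weight = (\<lambda>i j. if (i, j) \<in> parcs K then 1 else 0)\<rparr>"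

definition Cayley :: "('a, 'm) ring_scheme \<Rightarrow> 'a set \<Rightarrow> 'a pair_pre_digraph" where
  "Cayley \<Gamma> B = \<lparr>pverts = carrier \<Gamma>,
     parcs = {(i, j). i \<in> carrier \<Gamma> \<and> j \<in> carrier \<Gamma> \<and> j \<ominus>\<^bsub>\<Gamma>\<^esub> i \<in> B}\<rparr>"

definition dual_Cayley ::
  "('a, 'm) ring_scheme \<Rightarrow> ('a \<Rightarrow> complex) \<Rightarrow> 'a set \<Rightarrow> ('a, complex) weighted_graph" where
  "dual_Cayley \<Gamma> \<chi> B =
     \<lparr>nodes = carrier \<Gamma>, weight = (\<lambda>i j. fourier \<Gamma> \<chi> (indicator B) (j \<ominus>\<^bsub>\<Gamma>\<^esub> i))\<rparr>"

text \<open>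
  For \<open>B = -B\<close> both graphs are undirected, and the weights of the second one, which have type
  \<^typ>\<open>complex\<close>, are real.
\<close>

lemma (in abelian_group) sym_Cayley:
  assumes "a_inv G ` B = B"
  shows "sym (parcs (Cayley G B))"
proof (rule symI)
  fix i j assume "(i, j) \<in> parcs (Cayley G B)"
  then have *: "i \<in> carrier G" "j \<in> carrier G" "j \<ominus> i \<in> B" by (auto simp: Cayley_def)
  then have "i \<ominus> j = \<ominus> (j \<ominus> i)" by (simp add: a_minus_def minus_add a_comm)
  with * assms have "i \<ominus> j \<in> B" by (metis imageI)
  with * show "(j, i) \<in> parcs (Cayley G B)" by (simp add: Cayley_def)
qed

context cring
begin

lemma character_minus:
  assumes \<chi>: "\<chi> \<in> hom (add_monoid R) complex_units" and x: "x \<in> carrier R"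
  shows "\<chi> (\<ominus> x) = inverse (\<chi> x)"
proof -
  have m: "\<chi> (a \<oplus> b) = \<chi> a * \<chi> b" "\<chi> a \<noteq> 0" if "a \<in> carrier R" "b \<in> carrier R" for a b
    using that \<chi> by (auto simp: hom_def complex_units_def)
  have "\<chi> \<zero> = 1" using m[of \<zero> \<zero>] by simp
  then have "\<chi> x * \<chi> (\<ominus> x) = 1" using m(1)[of x "\<ominus> x"] x by (simp add: r_neg)
  then show ?thesis by (simp add: inverse_unique)
qed

lemma cnj_character:
  assumes \<chi>: "\<chi> \<in> hom (add_monoid R) complex_units" and x: "x \<in> carrier R"
    and fin: "finite (carrier R)"
  shows "cnj (\<chi> x) = \<chi> (\<ominus> x)"
proof -
  have m: "\<chi> (a \<oplus> b) = \<chi> a * \<chi> b" "\<chi> a \<noteq> 0" if "a \<in> carrier R" "b \<in> carrier R" for a b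
    using that \<chi> by (auto simp: hom_def complex_units_def)
  have z: "\<chi> \<zero> = 1" using m[of \<zero> \<zero>] by simp
  have pow: "\<chi> ([n] \<cdot> x) = \<chi> x ^ n" for n :: nat
    by (induction n) (use x m z in \<open>auto simp: add.nat_pow_Suc\<close>)
  have "[card (carrier R)] \<cdot> x = \<zero>"
    using add.pow_order_eq_1[of x] x by (simp add: order_def)
  then have "\<chi> x ^ card (carrier R) = 1" using pow z by metis
  moreover have "0 < card (carrier R)" using fin x by (auto simp: card_gt_0_iff)
  ultimately have "norm (\<chi> x) = 1"
    by (metis norm_power norm_one norm_ge_zero power_eq_1_iff gr_implies_not0)
  then have "cnj (\<chi> x) = inverse (\<chi> x)"
    by (simp add: inverse_complex_def complex_eq_iff cmod_def)
  then show ?thesis using character_minus[OF \<chi> x] by simp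
qed

lemma fourier_indicator_minus:
  assumes B: "B \<subseteq> carrier R" "a_inv R ` B = B" and y: "y \<in> carrier R"
  shows "fourier R \<chi> (indicator B) (\<ominus> y) = fourier R \<chi> (indicator B) y"
  unfolding fourier_def
proof (rule sum.reindex_bij_witness[where i = "a_inv R" and j = "a_inv R"])
  fix x assume x: "x \<in> carrier R"
  have "\<ominus> x \<in> B \<longleftrightarrow> x \<in> B" using B x by (metis imageI minus_minus)
  then show "indicator B (\<ominus> x) * char_twist R \<chi> y (\<ominus> (\<ominus> x)) =
      indicator B x * char_twist R \<chi> (\<ominus> y) (\<ominus> x)"
    using x y by (simp add: char_twist_def indicator_def l_minus r_minus)
qed auto

lemma symmetric_dual_Cayley:
  assumes "B \<subseteq> carrier R" "a_inv R ` B = B" "i \<in> carrier R" "j \<in> carrier R"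
  shows "weight (dual_Cayley R \<chi> B) i j = weight (dual_Cayley R \<chi> B) j i"
proof -
  have "i \<ominus> j = \<ominus> (j \<ominus> i)" using assms by (simp add: a_minus_def minus_add a_comm)
  then show ?thesis
    using fourier_indicator_minus[OF assms(1,2), of "j \<ominus> i"] assms by (simp add: dual_Cayley_def)
qed

lemma real_dual_Cayley:
  assumes B: "B \<subseteq> carrier R" "a_inv R ` B = B" and ij: "i \<in> carrier R" "j \<in> carrier R"
    and fin: "finite (carrier R)" and \<chi>: "generating_character R \<chi>"
  shows "weight (dual_Cayley R \<chi> B) i j \<in> \<real>"
proof -
  have hom: "\<chi> \<in> hom (add_monoid R) complex_units"
    using \<chi> by (simp add: generating_character_def)
  define y where "y = j \<ominus> i"
  have y: "y \<in> carrier R" using ij by (simp add: y_def)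
  have "cnj (fourier R \<chi> (indicator B) y) = fourier R \<chi> (indicator B) (\<ominus> y)"
    unfolding fourier_def cnj_sum
    by (rule sum.cong)
      (use y cnj_character[OF hom _ fin] in \<open>auto simp: char_twist_def indicator_def l_minus\<close>)
  also have "\<dots> = fourier R \<chi> (indicator B) y" by (rule fourier_indicator_minus[OF B y])
  finally show ?thesis by (simp add: dual_Cayley_def y_def Reals_cnj_iff)
qed

end

end

theory Submission
  imports Defs
begin

text \<open>
  Both identities come from writing a homomorphism number as a sum over vertex functions
  \<open>f : V \<rightarrow> \<Gamma>\<close> and regrouping this sum by edge functions.

  For tensions, let \<open>H\<close> be the Cayley graph.  The term of \<open>f\<close> in \<open>hom(G, H)\<close> is \<open>1\<close> if every
  potential difference of \<open>f\<close> along an edge lies in \<open>B\<close> and \<open>0\<close> otherwise.  The tensions are the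
  potential differences, and the potentials of a given tension form a coset of the functions that
  are constant on each connected component; hence each \<open>B\<close>-tension is counted \<open>|\<Gamma>|\<^sup>c\<close> times, where
  \<open>c\<close> is the number of components
  (\<open>card_arc_invariant_functions\<close>, \<open>card_potentials\<close>).

  For flows, let \<open>K\<close> be the dual Cayley graph.  The weight of an edge in \<open>hom(G, K)\<close> is a sum of
  values of \<open>\<chi>\<close> over \<open>B\<close>.  Multiplying out over the edges gives a sum over pairs of a vertex
  function \<open>f\<close> and an edge function \<open>g : E \<rightarrow> B\<close>.  Its term is the value of \<open>\<chi>\<close> at the pairing of
  the potential difference of \<open>f\<close> with \<open>-g\<close>, which by summation by parts is the pairing of \<open>f\<close>
  with the net outflow of \<open>g\<close> at the vertices (\<open>character_edge_vertex_duality\<close>).  For fixed \<open>g\<close>,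
  the sum over \<open>f\<close> then splits into one character sum per vertex, and orthogonality
  (\<open>sum_generating_character\<close>) makes it \<open>|\<Gamma>|\<^bsup>|V|\<^esup>\<close> if the net outflow vanishes everywhere, that
  is, if \<open>g\<close> is a flow, and \<open>0\<close> otherwise.
\<close>

section \<open>Tensions\<close>

text \<open>
  A function whose values agree at the two ends of every arc is constant on each connected
  component, so such functions are the pullbacks of arbitrary functions on the set of components.
\<close>

lemma (in fin_digraph) card_arc_invariant_functions:
  "card {h \<in> verts G \<rightarrow>\<^sub>E C. \<forall>e \<in> arcs G. h (head G e) = h (tail G e)} =
     card C ^ num_components G"
proof -
  interpret S: pair_fin_digraph "mk_symmetric G" ..
  let ?S = "with_proj (mk_symmetric G)"
  let ?K = "pre_digraph.sccs_verts ?S"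
  let ?c = "pre_digraph.scc_of ?S"
  let ?I = "{h \<in> verts G \<rightarrow>\<^sub>E C. \<forall>e \<in> arcs G. h (head G e) = h (tail G e)}"
  let ?pull = "\<lambda>k. \<lambda>v \<in> verts G. k (?c v)"
  have K: "?K = ?c ` verts G"
    using S.sccs_verts_conv_scc_of by simp
  have self: "v \<in> ?c v" if "v \<in> verts G" for v
    using S.in_scc_of_self that by simp
  have same: "?c (head G e) = ?c (tail G e)" if e: "e \<in> arcs G" for e
  proof (rule S.scc_of_eq)
    have "head G e \<rightarrow>\<^bsub>?S\<^esub> tail G e" "tail G e \<rightarrow>\<^bsub>?S\<^esub> head G e"
      using e by (auto simp: parcs_mk_symmetric)
    then show "head G e \<in> ?c (tail G e)"
      unfolding S.scc_of_def by (auto intro: S.reachable_adjI)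
  qed
  \<comment> \<open>Invariance propagates from single edges along walks.\<close>
  have const: "h u = h v" if h: "h \<in> ?I" and uv: "u \<in> ?c v" for h u v
  proof -
    have "v \<rightarrow>\<^sup>*\<^bsub>?S\<^esub> u" using uv by (simp add: S.scc_of_def)
    then show ?thesis
    proof (induction rule: S.reachable_induct)
      case (step x y)
      have "(x, y) \<in> parcs (mk_symmetric G)" using step(2) by simp
      then have "h x = h y" using h by (auto simp: parcs_mk_symmetric)
      then show ?case using step by simp
    qed simp
  qed
  have "bij_betw ?pull (?K \<rightarrow>\<^sub>E C) ?I"
  proof (rule bij_betwI')
    fix k l assume k: "k \<in> ?K \<rightarrow>\<^sub>E C" and l: "l \<in> ?K \<rightarrow>\<^sub>E C"
    show "?pull k = ?pull l \<longleftrightarrow> k = l"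
    proof
      assume eq: "?pull k = ?pull l"
      show "k = l"
      proof (rule PiE_ext[OF k l])
        fix T assume "T \<in> ?K"
        then obtain v where v: "v \<in> verts G" "T = ?c v" using K by auto
        then show "k T = l T" using fun_cong[OF eq, of v] by simp
      qed
    qed simp
  next
    fix k assume "k \<in> ?K \<rightarrow>\<^sub>E C"
    then show "?pull k \<in> ?I" using same K by auto
  next
    fix h assume h: "h \<in> ?I"
    \<comment> \<open>The preimage of \<open>h\<close> reads off the common value of \<open>h\<close> on a component at any of its vertices.\<close>
    define k where "k = (\<lambda>T \<in> ?K. h (SOME v. v \<in> T))"
    have some: "h (SOME u. u \<in> ?c v) = h v" if "v \<in> verts G" for v
      using const[OF h] someI[of "\<lambda>u. u \<in> ?c v", OF self[OF that]] by blast
    have "k \<in> ?K \<rightarrow>\<^sub>E C" using h some K by (auto simp: k_def)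
    moreover have "h = ?pull k"
    proof
      fix v show "h v = ?pull k v"
        using h some[of v] K by (auto simp: k_def PiE_def extensional_def)
    qed
    ultimately show "\<exists>k \<in> ?K \<rightarrow>\<^sub>E C. h = ?pull k" by blast
  qed
  then have "card ?I = card (?K \<rightarrow>\<^sub>E C)" by (rule bij_betw_same_card[symmetric])
  also have "\<dots> = card C ^ card ?K"
    using S.finite_sccs_verts by (rule card_funcsetE)
  finally show ?thesis by (simp add: num_components_def S.card_sccs_verts)
qed

definition potential_difference ::
  "('v, 'e) pre_digraph \<Rightarrow> ('a, 'm) ring_scheme \<Rightarrow> ('v \<Rightarrow> 'a) \<Rightarrow> 'e \<Rightarrow> 'a" where
  "potential_difference D \<Gamma> f = (\<lambda>e \<in> arcs D. f (head D e) \<ominus>\<^bsub>\<Gamma>\<^esub> f (tail D e))"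

lemma (in fin_digraph) hom_number_Cayley_eq_card_functions:
  assumes fin: "finite (carrier \<Gamma>)"
  shows "hom_number G (unit_weighted (Cayley \<Gamma> B)) =
    of_nat (card {f \<in> verts G \<rightarrow>\<^sub>E carrier \<Gamma>. \<forall>e \<in> arcs G. potential_difference G \<Gamma> f e \<in> B})"
proof -
  have "hom_number G (unit_weighted (Cayley \<Gamma> B)) =
      (\<Sum>f \<in> verts G \<rightarrow>\<^sub>E carrier \<Gamma>. if \<forall>e \<in> arcs G. potential_difference G \<Gamma> f e \<in> B then 1 else 0)"
    unfolding hom_number_def
  proof (rule sum.cong)
    fix f assume "f \<in> verts G \<rightarrow>\<^sub>E carrier \<Gamma>"
    then have "f (head G e) \<in> carrier \<Gamma>" "f (tail G e) \<in> carrier \<Gamma>" if "e \<in> arcs G" for e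
      using that by auto
    then have "(f (tail G e), f (head G e)) \<in> parcs (Cayley \<Gamma> B) \<longleftrightarrow>
        potential_difference G \<Gamma> f e \<in> B" if "e \<in> arcs G" for e
      using that by (simp add: Cayley_def potential_difference_def)
    then show "(\<Prod>e\<in>arcs G. weight (unit_weighted (Cayley \<Gamma> B)) (f (tail G e)) (f (head G e))) =
        (if \<forall>e \<in> arcs G. potential_difference G \<Gamma> f e \<in> B then 1 else 0)"
      by (auto simp: unit_weighted_def intro!: prod.neutral prod_zero)
  qed (simp add: unit_weighted_def Cayley_def)
  also have "\<dots> = of_nat (card {f \<in> verts G \<rightarrow>\<^sub>E carrier \<Gamma>. \<forall>e \<in> arcs G. potential_difference G \<Gamma> f e \<in> B})"
    by (simp add: sum.inter_filter[symmetric] finite_PiE fin)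
  finally show ?thesis .
qed

context abelian_group
begin

lemma minus_eq_zero_iff:
  assumes "a \<in> carrier G" "b \<in> carrier G"
  shows "a \<ominus> b = \<zero> \<longleftrightarrow> a = b"
proof
  assume "a \<ominus> b = \<zero>"
  then have "\<ominus> (\<ominus> b) = a"
    using assms by (intro minus_equality) (auto simp: a_minus_def)
  then show "a = b" using assms by simp
qed (use assms in \<open>simp add: a_minus_def r_neg\<close>)

text \<open>
  The fibres of the potential difference are cosets of the arc-invariant functions: rearranging
  the equation of the differences along an arc makes it say that \<open>f - f'\<close> agrees at both ends.
\<close>

lemma potential_difference_eq_iff:
  assumes "wf_digraph D" and f: "f \<in> verts D \<rightarrow> carrier G" and f': "f' \<in> verts D \<rightarrow> carrier G"
  shows "potential_difference D G f = potential_difference D G f' \<longleftrightarrow>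
    (\<forall>e \<in> arcs D. f (head D e) \<ominus> f' (head D e) = f (tail D e) \<ominus> f' (tail D e))"
proof -
  interpret D: wf_digraph D by fact
  have *: "a \<ominus> b = a' \<ominus> b' \<longleftrightarrow> a \<ominus> a' = b \<ominus> b'"
    if "a \<in> carrier G" "b \<in> carrier G" "a' \<in> carrier G" "b' \<in> carrier G" for a b a' b'
  proof -
    have "(a \<ominus> b) \<ominus> (a' \<ominus> b') = (a \<ominus> a') \<ominus> (b \<ominus> b')"
      using that by (simp add: a_minus_def minus_add a_ac)
    then show ?thesis
      using that minus_eq_zero_iff[of "a \<ominus> b" "a' \<ominus> b'"]
        minus_eq_zero_iff[of "a \<ominus> a'" "b \<ominus> b'"] by simp
  qed
  have "f (head D e) \<ominus> f (tail D e) = f' (head D e) \<ominus> f' (tail D e) \<longleftrightarrow>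
      f (head D e) \<ominus> f' (head D e) = f (tail D e) \<ominus> f' (tail D e)" if "e \<in> arcs D" for e
    by (rule *) (use f f' that in auto)
  then show ?thesis
    by (auto simp: potential_difference_def fun_eq_iff restrict_def)
qed

text \<open>
  Subtracting the fixed potential \<open>f\<close> is a bijection from the potentials with the same difference
  onto the arc-invariant functions.
\<close>

lemma card_potentials:
  assumes "fin_digraph D" and f: "f \<in> verts D \<rightarrow>\<^sub>E carrier G"
  shows "card {f' \<in> verts D \<rightarrow>\<^sub>E carrier G.
      potential_difference D G f' = potential_difference D G f} =
    card (carrier G) ^ num_components D"
proof -
  interpret D: fin_digraph D by fact
  let ?P = "{f' \<in> verts D \<rightarrow>\<^sub>E carrier G.
      potential_difference D G f' = potential_difference D G f}"
  let ?I = "{h \<in> verts D \<rightarrow>\<^sub>E carrier G. \<forall>e \<in> arcs D. h (head D e) = h (tail D e)}"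
  have fv: "f v \<in> carrier G" if "v \<in> verts D" for v using f that by auto
  have cancel1: "(x \<oplus> y) \<ominus> y = x" and cancel2: "(x \<ominus> y) \<oplus> y = x"
    if "x \<in> carrier G" "y \<in> carrier G" for x y
    using that by (simp_all add: a_minus_def a_assoc r_neg l_neg)
  have "bij_betw (\<lambda>f'. \<lambda>v \<in> verts D. f' v \<ominus> f v) ?P ?I"
  proof (rule bij_betw_byWitness[where f' = "\<lambda>h. \<lambda>v \<in> verts D. h v \<oplus> f v"])
    show "\<forall>f' \<in> ?P. (\<lambda>v \<in> verts D. (\<lambda>v \<in> verts D. f' v \<ominus> f v) v \<oplus> f v) = f'"
      using fv by (auto simp: fun_eq_iff cancel2 PiE_def Pi_def extensional_def)
    show "\<forall>h \<in> ?I. (\<lambda>v \<in> verts D. (\<lambda>v \<in> verts D. h v \<oplus> f v) v \<ominus> f v) = h"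
      using fv by (auto simp: fun_eq_iff cancel1 PiE_def Pi_def extensional_def)
    show "(\<lambda>f'. \<lambda>v \<in> verts D. f' v \<ominus> f v) ` ?P \<subseteq> ?I"
    proof (rule image_subsetI)
      fix f' assume f': "f' \<in> ?P"
      then have "\<forall>e \<in> arcs D. f' (head D e) \<ominus> f (head D e) = f' (tail D e) \<ominus> f (tail D e)"
        using potential_difference_eq_iff[OF D.wf_digraph_axioms, of f' f] f by (auto simp: PiE_def)
      then show "(\<lambda>v \<in> verts D. f' v \<ominus> f v) \<in> ?I" using f' fv by auto
    qed
    show "(\<lambda>h. \<lambda>v \<in> verts D. h v \<oplus> f v) ` ?I \<subseteq> ?P"
    proof (rule image_subsetI)
      fix h assume h: "h \<in> ?I"
      let ?f' = "\<lambda>v \<in> verts D. h v \<oplus> f v"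
      have f': "?f' \<in> verts D \<rightarrow>\<^sub>E carrier G" using h fv by auto
      have diff: "?f' v \<ominus> f v = h v" if "v \<in> verts D" for v
        using that h fv by (auto simp: cancel1 PiE_def Pi_def)
      have "\<forall>e \<in> arcs D. ?f' (head D e) \<ominus> f (head D e) = ?f' (tail D e) \<ominus> f (tail D e)"
      proof
        fix e assume e: "e \<in> arcs D"
        have "?f' (head D e) \<ominus> f (head D e) = h (head D e)"
          using e by (intro diff D.head_in_verts)
        also have "\<dots> = h (tail D e)" using h e by blast
        also have "\<dots> = ?f' (tail D e) \<ominus> f (tail D e)"
          using e by (intro diff[symmetric] D.tail_in_verts)
        finally show "?f' (head D e) \<ominus> f (head D e) = ?f' (tail D e) \<ominus> f (tail D e)" .
      qed
      then show "?f' \<in> ?P"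
        using potential_difference_eq_iff[OF D.wf_digraph_axioms, of ?f' f] f f' by (simp add: PiE_def)
    qed
  qed
  then have "card ?P = card ?I" by (rule bij_betw_same_card)
  then show ?thesis by (simp add: D.card_arc_invariant_functions)
qed

text \<open>
  Restricting a potential to the vertex set does not change its differences.  The extensional
  potentials are the ones that a homomorphism number sums over.
\<close>

lemma tensions_eq_image:
  assumes "wf_digraph D"
  shows "tensions D G = potential_difference D G ` (verts D \<rightarrow>\<^sub>E carrier G)"
proof -
  interpret D: wf_digraph D by fact
  show ?thesis
  proof (intro subset_antisym subsetI)
    fix g assume "g \<in> tensions D G"
    then obtain f where f: "f \<in> verts D \<rightarrow> carrier G" and g: "g \<in> arcs D \<rightarrow>\<^sub>E carrier G"
      and gf: "\<forall>e \<in> arcs D. g e = f (head D e) \<ominus> f (tail D e)"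
      by (auto simp: tensions_def)
    have "g = potential_difference D G (restrict f (verts D))"
      using g gf by (auto simp: potential_difference_def fun_eq_iff PiE_def extensional_def)
    then show "g \<in> potential_difference D G ` (verts D \<rightarrow>\<^sub>E carrier G)"
      using f by (intro image_eqI[of _ _ "restrict f (verts D)"]) auto
  next
    fix g assume "g \<in> potential_difference D G ` (verts D \<rightarrow>\<^sub>E carrier G)"
    then obtain f where f: "f \<in> verts D \<rightarrow>\<^sub>E carrier G" and g: "g = potential_difference D G f"
      by auto
    have "g \<in> arcs D \<rightarrow>\<^sub>E carrier G"
      using f unfolding g potential_difference_def by (auto intro!: minus_closed)
    moreover have "\<forall>e \<in> arcs D. g e = f (head D e) \<ominus> f (tail D e)"
      by (simp add: g potential_difference_def)
    ultimately show "g \<in> tensions D G" using f by (auto simp: tensions_def)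
  qed
qed

text \<open>
  Counting the homomorphisms to the Cayley graph by their potential difference: the differences
  that occur are the \<open>B\<close>-tensions, and all fibres have the same size.
\<close>

lemma hom_number_Cayley_eq_card_tensions:
  assumes "fin_digraph D" and fin: "finite (carrier G)"
  shows "hom_number D (unit_weighted (Cayley G B)) =
    of_nat (card (carrier G) ^ num_components D * card (B_tensions D G B))"
proof -
  interpret D: fin_digraph D by fact
  let ?\<delta> = "potential_difference D G"
  let ?F = "{f \<in> verts D \<rightarrow>\<^sub>E carrier G. \<forall>e \<in> arcs D. ?\<delta> f e \<in> B}"
  have finF: "finite ?F" by (simp add: finite_PiE fin)
  have image: "B_tensions D G B = ?\<delta> ` ?F"
    unfolding B_tensions_def tensions_eq_image[OF D.wf_digraph_axioms] by auto
  have fibre: "card {f \<in> ?F. ?\<delta> f = g} = card (carrier G) ^ num_components D"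
    if g: "g \<in> ?\<delta> ` ?F" for g
  proof -
    obtain f where f: "g = ?\<delta> f" "f \<in> ?F" using g by (rule imageE)
    then have "{f \<in> ?F. ?\<delta> f = g} = {f' \<in> verts D \<rightarrow>\<^sub>E carrier G. ?\<delta> f' = ?\<delta> f}" by auto
    then show ?thesis using f card_potentials[OF assms(1), of f] by simp
  qed
  have "card ?F = (\<Sum>g \<in> ?\<delta> ` ?F. card {f \<in> ?F. ?\<delta> f = g})"
    using sum.group[OF finF, of "?\<delta> ` ?F" ?\<delta> "\<lambda>_. 1 :: nat"] finF by simp
  also have "\<dots> = (\<Sum>g \<in> ?\<delta> ` ?F. card (carrier G) ^ num_components D)"
    by (rule sum.cong[OF refl fibre])
  also have "\<dots> = card (carrier G) ^ num_components D * card (B_tensions D G B)"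
    by (simp only: image sum_constant of_nat_id mult.commute)
  finally show ?thesis
    unfolding D.hom_number_Cayley_eq_card_functions[OF fin] by (rule arg_cong)
qed

end

section \<open>Characters\<close>

context abelian_group
begin

lemma character_add:
  assumes "\<chi> \<in> hom (add_monoid G) complex_units" "x \<in> carrier G" "y \<in> carrier G"
  shows "\<chi> (x \<oplus> y) = \<chi> x * \<chi> y"
  using assms by (simp add: hom_def complex_units_def)

lemma character_zero:
  assumes "\<chi> \<in> hom (add_monoid G) complex_units"
  shows "\<chi> \<zero> = 1"
proof -
  have "\<chi> \<zero> \<noteq> 0" using assms by (auto simp: hom_def complex_units_def)
  moreover have "\<chi> \<zero> = \<chi> \<zero> * \<chi> \<zero>" using character_add[OF assms, of \<zero> \<zero>] by simp
  ultimately show ?thesis by simp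
qed

lemma character_finsum:
  assumes \<chi>: "\<chi> \<in> hom (add_monoid G) complex_units"
    and "finite A" and "f \<in> A \<rightarrow> carrier G"
  shows "\<chi> (\<Oplus>x \<in> A. f x) = (\<Prod>x \<in> A. \<chi> (f x))"
  using assms(2,3)
proof (induction A rule: finite_induct)
  case (insert a A)
  then show ?case by (simp add: finsum_insert character_add[OF \<chi>] finsum_closed)
qed (simp add: character_zero[OF \<chi>])

text \<open>
  Translation by \<open>a\<close> permutes the group and multiplies the sum by \<open>\<chi> a \<noteq> 1\<close>.
\<close>

lemma sum_nontrivial_character:
  assumes \<chi>: "\<chi> \<in> hom (add_monoid G) complex_units"
    and a: "a \<in> carrier G" "\<chi> a \<noteq> 1"
  shows "(\<Sum>x \<in> carrier G. \<chi> x) = 0"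
proof -
  have "(\<Sum>x \<in> carrier G. \<chi> x) = (\<Sum>x \<in> carrier G. \<chi> (a \<oplus> x))"
    by (rule sum.reindex_bij_witness[where i = "\<lambda>x. a \<oplus> x" and j = "\<lambda>x. \<ominus> a \<oplus> x"])
      (use a in \<open>auto simp: a_assoc[symmetric] l_neg r_neg\<close>)
  also have "\<dots> = \<chi> a * (\<Sum>x \<in> carrier G. \<chi> x)"
    using a by (simp add: character_add[OF \<chi>] sum_distrib_left)
  finally show ?thesis using a by simp
qed

end

context cring
begin

lemma char_twist_hom:
  assumes \<chi>: "\<chi> \<in> hom (add_monoid R) complex_units" and y: "y \<in> carrier R"
  shows "char_twist R \<chi> y \<in> hom (add_monoid R) complex_units"
  using assms by (auto simp: hom_def char_twist_def complex_units_def r_distr Pi_def)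

text \<open>
  Orthogonality.  The map \<open>x \<mapsto> \<chi> (x \<otimes> y)\<close> is the character attached to \<open>y\<close>; injectivity of
  this attachment, which is part of being generating, makes it nontrivial for \<open>y \<noteq> \<zero>\<close>.
\<close>

lemma sum_generating_character:
  assumes \<chi>: "generating_character R \<chi>" and y: "y \<in> carrier R"
  shows "(\<Sum>x \<in> carrier R. \<chi> (x \<otimes> y)) = (if y = \<zero> then of_nat (card (carrier R)) else 0)"
proof -
  have hom: "\<chi> \<in> hom (add_monoid R) complex_units"
    and inj: "inj_on (char_twist R \<chi>) (carrier R)"
    using \<chi> by (auto simp: generating_character_def iso_def bij_betw_def)
  have sum: "(\<Sum>x \<in> carrier R. \<chi> (x \<otimes> y)) = (\<Sum>x \<in> carrier R. char_twist R \<chi> y x)"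
    using y by (intro sum.cong) (auto simp: char_twist_def m_comm)
  show ?thesis
  proof (cases "y = \<zero>")
    case True
    then show ?thesis by (simp add: character_zero[OF hom])
  next
    case False
    then have "char_twist R \<chi> y \<noteq> char_twist R \<chi> \<zero>" using inj y by (auto dest: inj_onD)
    then obtain a where "a \<in> carrier R" "char_twist R \<chi> y a \<noteq> 1"
      by (fastforce simp: char_twist_def character_zero[OF hom])
    then show ?thesis
      using sum_nontrivial_character[OF char_twist_hom[OF hom y]] False by (simp add: sum)
  qed
qed

end

section \<open>Flows\<close>

text \<open>
  Loops are left out, as in the definition of a flow; they would contribute equally to both
  sums.
\<close>

definition outflow :: "('v, 'e) pre_digraph \<Rightarrow> ('a, 'm) ring_scheme \<Rightarrow> ('e \<Rightarrow> 'a) \<Rightarrow> 'v \<Rightarrow> 'a" where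
  "outflow D \<Gamma> g v = (\<Oplus>\<^bsub>\<Gamma>\<^esub> e \<in> {e \<in> arcs D. tail D e \<noteq> head D e \<and> tail D e = v}. g e)"

definition inflow :: "('v, 'e) pre_digraph \<Rightarrow> ('a, 'm) ring_scheme \<Rightarrow> ('e \<Rightarrow> 'a) \<Rightarrow> 'v \<Rightarrow> 'a" where
  "inflow D \<Gamma> g v = (\<Oplus>\<^bsub>\<Gamma>\<^esub> e \<in> {e \<in> arcs D. tail D e \<noteq> head D e \<and> head D e = v}. g e)"

context cring
begin

text \<open>
  Summation by parts in multiplicative form: the potential difference is adjoint to the net
  outflow.  The factor of an arc \<open>e\<close> from \<open>u\<close> to \<open>v\<close> equals \<open>\<chi> (f u \<otimes> g e) / \<chi> (f v \<otimes> g e)\<close>,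
  so the numerators can be collected at the tails and the denominators at the heads.  The minus
  sign in front of \<open>g e\<close> is the one in the Fourier transform.
\<close>

lemma character_edge_vertex_duality:
  assumes "fin_digraph D" and \<chi>: "\<chi> \<in> hom (add_monoid R) complex_units"
    and f: "f \<in> verts D \<rightarrow> carrier R" and g: "g \<in> arcs D \<rightarrow> carrier R"
  shows "(\<Prod>e \<in> arcs D. \<chi> ((f (head D e) \<ominus> f (tail D e)) \<otimes> \<ominus> g e)) =
    (\<Prod>v \<in> verts D. \<chi> (f v \<otimes> (outflow D R g v \<ominus> inflow D R g v)))"
proof -
  interpret D: fin_digraph D by fact
  let ?A = "{e \<in> arcs D. tail D e \<noteq> head D e}"
  have fv: "f v \<in> carrier R" if "v \<in> verts D" for v using f that by auto
  have ge: "g e \<in> carrier R" if "e \<in> arcs D" for e using g that by auto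
  have flow_closed: "outflow D R g v \<in> carrier R" "inflow D R g v \<in> carrier R" for v
    using ge by (auto simp: outflow_def inflow_def intro!: finsum_closed)
  \<comment> \<open>\<open>x \<mapsto> \<chi> (f v \<otimes> x)\<close> is again a character, so it turns sums into products.\<close>
  have twist: "\<chi> (f v \<otimes> (\<Oplus>e \<in> E. g e)) = (\<Prod>e \<in> E. \<chi> (f v \<otimes> g e))"
    if v: "v \<in> verts D" and E: "E \<subseteq> arcs D" for v E
  proof -
    have "finite E" using E D.finite_arcs by (rule finite_subset)
    moreover have "g \<in> E \<rightarrow> carrier R" using E ge by auto
    moreover from this have "(\<Oplus>e \<in> E. g e) \<in> carrier R" by (rule finsum_closed)
    moreover have "(\<Prod>e \<in> E. char_twist R \<chi> (f v) (g e)) = (\<Prod>e \<in> E. \<chi> (f v \<otimes> g e))"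
      using E ge by (intro prod.cong) (auto simp: char_twist_def)
    ultimately show ?thesis
      using character_finsum[OF char_twist_hom[OF \<chi> fv[OF v]], of E g]
      by (simp add: char_twist_def)
  qed
  \<comment> \<open>A loop has potential difference \<open>\<zero>\<close>, hence factor \<open>1\<close>.\<close>
  have "(\<Prod>e \<in> arcs D. \<chi> ((f (head D e) \<ominus> f (tail D e)) \<otimes> \<ominus> g e)) =
      (\<Prod>e \<in> ?A. \<chi> ((f (head D e) \<ominus> f (tail D e)) \<otimes> \<ominus> g e))"
  proof (rule prod.mono_neutral_right)
    show "\<forall>e \<in> arcs D - ?A. \<chi> ((f (head D e) \<ominus> f (tail D e)) \<otimes> \<ominus> g e) = 1"
      using fv ge by (auto simp: a_minus_def r_neg character_zero[OF \<chi>])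
  qed auto
  also have "\<dots> = (\<Prod>e \<in> ?A. \<chi> (f (tail D e) \<otimes> g e) * inverse (\<chi> (f (head D e) \<otimes> g e)))"
  proof (rule prod.cong)
    fix e assume "e \<in> ?A"
    then have c: "f (head D e) \<in> carrier R" "f (tail D e) \<in> carrier R" "g e \<in> carrier R"
      using fv ge by auto
    then have "(f (head D e) \<ominus> f (tail D e)) \<otimes> \<ominus> g e =
        f (tail D e) \<otimes> g e \<oplus> \<ominus> (f (head D e) \<otimes> g e)"
      by (simp add: a_minus_def l_distr l_minus r_minus minus_add a_comm)
    then show "\<chi> ((f (head D e) \<ominus> f (tail D e)) \<otimes> \<ominus> g e) =
        \<chi> (f (tail D e) \<otimes> g e) * inverse (\<chi> (f (head D e) \<otimes> g e))"
      using c by (simp add: character_add[OF \<chi>] character_minus[OF \<chi>])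
  qed simp
  also have "\<dots> = (\<Prod>e \<in> ?A. \<chi> (f (tail D e) \<otimes> g e)) *
      inverse (\<Prod>e \<in> ?A. \<chi> (f (head D e) \<otimes> g e))"
    by (simp add: prod.distrib prod_inversef[symmetric] comp_def)
  also have "(\<Prod>e \<in> ?A. \<chi> (f (tail D e) \<otimes> g e)) = (\<Prod>v \<in> verts D. \<chi> (f v \<otimes> outflow D R g v))"
  proof -
    have "(\<Prod>e \<in> ?A. \<chi> (f (tail D e) \<otimes> g e)) =
        (\<Prod>v \<in> verts D. \<Prod>e \<in> {e \<in> ?A. tail D e = v}. \<chi> (f (tail D e) \<otimes> g e))"
      by (rule prod.group[symmetric]) auto
    also have "\<dots> = (\<Prod>v \<in> verts D. \<chi> (f v \<otimes> outflow D R g v))"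
      by (intro prod.cong refl) (auto simp: outflow_def twist conj_assoc intro!: prod.cong)
    finally show ?thesis .
  qed
  also have "(\<Prod>e \<in> ?A. \<chi> (f (head D e) \<otimes> g e)) = (\<Prod>v \<in> verts D. \<chi> (f v \<otimes> inflow D R g v))"
  proof -
    have "(\<Prod>e \<in> ?A. \<chi> (f (head D e) \<otimes> g e)) =
        (\<Prod>v \<in> verts D. \<Prod>e \<in> {e \<in> ?A. head D e = v}. \<chi> (f (head D e) \<otimes> g e))"
      by (rule prod.group[symmetric]) auto
    also have "\<dots> = (\<Prod>v \<in> verts D. \<chi> (f v \<otimes> inflow D R g v))"
      by (intro prod.cong refl) (auto simp: inflow_def twist conj_assoc intro!: prod.cong)
    finally show ?thesis .
  qed
  also have "(\<Prod>v \<in> verts D. \<chi> (f v \<otimes> outflow D R g v)) *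
      inverse (\<Prod>v \<in> verts D. \<chi> (f v \<otimes> inflow D R g v)) =
      (\<Prod>v \<in> verts D. \<chi> (f v \<otimes> (outflow D R g v \<ominus> inflow D R g v)))"
    unfolding prod_inversef[symmetric] prod.distrib[symmetric] comp_def
    by (intro prod.cong refl)
      (simp add: a_minus_def r_distr r_minus character_add[OF \<chi>] character_minus[OF \<chi>]
        fv flow_closed)
  finally show ?thesis .
qed

text \<open>
  Expanding the product of the Fourier transforms gives a double sum over vertex functions and
  \<open>B\<close>-valued edge functions; after the exchange of the two sums and summation by parts, each
  inner sum is a product of orthogonality relations, one for each vertex.
\<close>

lemma hom_number_dual_Cayley_eq_card_flows:
  assumes "fin_digraph D" and fin: "finite (carrier R)" and B: "B \<subseteq> carrier R"
    and \<chi>: "generating_character R \<chi>"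
  shows "hom_number D (dual_Cayley R \<chi> B) =
    of_nat (card (carrier R) ^ card (verts D) * card (B_flows D R B))"
proof -
  interpret D: fin_digraph D by fact
  have hom: "\<chi> \<in> hom (add_monoid R) complex_units"
    using \<chi> by (simp add: generating_character_def)
  have finB: "finite B" using B fin by (rule finite_subset)
  let ?V = "verts D \<rightarrow>\<^sub>E carrier R" and ?E = "arcs D \<rightarrow>\<^sub>E B"
  let ?d = "\<lambda>g v. outflow D R g v \<ominus> inflow D R g v"
  let ?\<chi> = "\<lambda>f g. \<Prod>e \<in> arcs D. \<chi> ((f (head D e) \<ominus> f (tail D e)) \<otimes> \<ominus> g e)"
  have E_closed: "g \<in> arcs D \<rightarrow> carrier R" if "g \<in> ?E" for g
    using that B by auto
  have flow_closed: "outflow D R g v \<in> carrier R" "inflow D R g v \<in> carrier R"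
    if "g \<in> ?E" for g v
    using E_closed[OF that] by (auto simp: outflow_def inflow_def intro!: finsum_closed)
  have fourier: "fourier R \<chi> (indicator B) y = (\<Sum>x \<in> B. \<chi> (y \<otimes> \<ominus> x))" for y
  proof -
    have "fourier R \<chi> (indicator B) y = (\<Sum>x \<in> B. indicator B x * char_twist R \<chi> y (\<ominus> x))"
      unfolding fourier_def by (rule sum.mono_neutral_right[OF fin B]) auto
    also have "\<dots> = (\<Sum>x \<in> B. \<chi> (y \<otimes> \<ominus> x))"
      using B by (intro sum.cong) (auto simp: char_twist_def)
    finally show ?thesis .
  qed
  have "hom_number D (dual_Cayley R \<chi> B) =
      (\<Sum>f \<in> ?V. \<Prod>e \<in> arcs D. \<Sum>x \<in> B. \<chi> ((f (head D e) \<ominus> f (tail D e)) \<otimes> \<ominus> x))"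
    by (simp add: hom_number_def dual_Cayley_def fourier)
  also have "\<dots> = (\<Sum>f \<in> ?V. \<Sum>g \<in> ?E. ?\<chi> f g)"
    by (simp add: prod_sum_PiE finB)
  also have "\<dots> = (\<Sum>g \<in> ?E. \<Sum>f \<in> ?V. ?\<chi> f g)"
    by (rule sum.swap)
  also have "\<dots> = (\<Sum>g \<in> ?E. \<Sum>f \<in> ?V. \<Prod>v \<in> verts D. \<chi> (f v \<otimes> ?d g v))"
    by (intro sum.cong refl character_edge_vertex_duality[OF assms(1) hom] E_closed)
      (auto simp: PiE_def)
  also have "\<dots> = (\<Sum>g \<in> ?E. \<Prod>v \<in> verts D. \<Sum>x \<in> carrier R. \<chi> (x \<otimes> ?d g v))"
    by (simp add: prod_sum_PiE fin)
  \<comment> \<open>The product over the vertices is nonzero only if the net outflow of \<open>g\<close> is \<open>\<zero>\<close> everywhere.\<close>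
  also have "\<dots> = (\<Sum>g \<in> ?E. if g \<in> B_flows D R B
      then of_nat (card (carrier R)) ^ card (verts D) else 0)"
  proof (rule sum.cong)
    fix g assume g: "g \<in> ?E"
    have zero_iff: "?d g v = \<zero> \<longleftrightarrow> inflow D R g v = outflow D R g v" for v
      using flow_closed[OF g] by (auto simp: minus_eq_zero_iff)
    have "g \<in> arcs D \<rightarrow>\<^sub>E carrier R" "\<forall>e \<in> arcs D. g e \<in> B"
      using g B by auto
    then have "g \<in> B_flows D R B \<longleftrightarrow> (\<forall>v \<in> verts D. inflow D R g v = outflow D R g v)"
      by (simp add: B_flows_def flows_def inflow_def outflow_def)
    then have flow_iff: "g \<in> B_flows D R B \<longleftrightarrow> (\<forall>v \<in> verts D. ?d g v = \<zero>)"
      by (simp add: zero_iff)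
    have "(\<Prod>v \<in> verts D. \<Sum>x \<in> carrier R. \<chi> (x \<otimes> ?d g v)) =
        (\<Prod>v \<in> verts D. if ?d g v = \<zero> then of_nat (card (carrier R)) else 0)"
      using flow_closed[OF g] by (intro prod.cong refl sum_generating_character[OF \<chi>]) auto
    also have "\<dots> = (if g \<in> B_flows D R B then of_nat (card (carrier R)) ^ card (verts D) else 0)"
      unfolding flow_iff by (auto intro!: prod_zero)
    finally show "(\<Prod>v \<in> verts D. \<Sum>x \<in> carrier R. \<chi> (x \<otimes> ?d g v)) =
        (if g \<in> B_flows D R B then of_nat (card (carrier R)) ^ card (verts D) else 0)" .
  qed simp
  also have "\<dots> = of_nat (card (carrier R) ^ card (verts D) * card (B_flows D R B))"
  proof -
    have "B_flows D R B \<subseteq> ?E" by (auto simp: B_flows_def flows_def)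
    then have "{g \<in> ?E. g \<in> B_flows D R B} = B_flows D R B" by auto
    then show ?thesis by (simp add: sum.inter_filter[symmetric] finite_PiE finB)
  qed
  finally show ?thesis .
qed

end

theorem lemma3:
  fixes \<Gamma> :: "('a, 'm) ring_scheme" and B :: "'a set"
  assumes "abelian_group \<Gamma>" and "finite (carrier \<Gamma>)"
    and "B \<subseteq> carrier \<Gamma>" and "a_inv \<Gamma> ` B = B"
  shows "(\<forall>G :: ('v, 'e) pre_digraph. fin_digraph G \<longrightarrow>
        real (card (B_tensions G \<Gamma> B)) =
          real (card (carrier \<Gamma>)) powi (- int (num_components G)) *
          hom_number G (unit_weighted (Cayley \<Gamma> B))) \<and>
    (\<forall>\<chi>. cring \<Gamma> \<and> generating_character \<Gamma> \<chi> \<longrightarrow>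
      (\<forall>G :: ('v, 'e) pre_digraph. fin_digraph G \<longrightarrow>
        complex_of_nat (card (B_flows G \<Gamma> B)) =
          complex_of_nat (card (carrier \<Gamma>)) powi (- int (card (verts G))) *
          hom_number G (dual_Cayley \<Gamma> \<chi> B)))"
proof -
  interpret abelian_group \<Gamma> by fact
  have pos: "card (carrier \<Gamma>) \<noteq> 0" using assms(2) by auto
  have "real (card (B_tensions G \<Gamma> B)) =
      real (card (carrier \<Gamma>)) powi (- int (num_components G)) *
      hom_number G (unit_weighted (Cayley \<Gamma> B))"
    if "fin_digraph G" for G :: "('v, 'e) pre_digraph"
    unfolding hom_number_Cayley_eq_card_tensions[OF that assms(2)]
    using pos by (simp add: power_int_minus field_simps)
  moreover have "complex_of_nat (card (B_flows G \<Gamma> B)) =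
      complex_of_nat (card (carrier \<Gamma>)) powi (- int (card (verts G))) *
      hom_number G (dual_Cayley \<Gamma> \<chi> B)"
    if "cring \<Gamma>" "generating_character \<Gamma> \<chi>" "fin_digraph G"
    for \<chi> and G :: "('v, 'e) pre_digraph"
    unfolding cring.hom_number_dual_Cayley_eq_card_flows[OF that(1,3) assms(2,3) that(2)]
    using pos by (simp add: power_int_minus field_simps)
  ultimately show ?thesis by blast
qed

end
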